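(* Let $m\ge 2$ be an integer with $m\equiv 0\pmod 3$ and let $f:\mathbb{Z}_3\to\mathbb{Z}_3$, $f(x)=x^m$. 1. If $m\equiv 0\pmod 6$, then the minimal decomposition of $\mathbb{Z}_3$ for $f$ is $$\mathbb{Z}_3=\{0,1\}\ \bigsqcup\ \big((3\mathbb{Z}_3\setminus\{0\})\cup((1+3\mathbb{Z}_3)\setminus\{1\})\cup(-1+3\mathbb{Z}_3)\big).$$ Here $\{0,1\}$ is the set of periodic points (all of them fixed points), there are no minimal components, and the other sets are the attracting basin of $\{0,1\}$. 2. If $m\equiv 3\pmod 6$, then the minimal decomposition of $\mathbb{Z}_3$ for $f$ is $$\mathbb{Z}_3=\{0,\pm1\}\ \bigsqcup\ \big((3\mathbb{Z}_3\setminus\{0\})\cup((1+3\mathbb{Z}_3)\setminus\{1\})\cup((-1+3\mathbb{Z}_3)\setminus\{-1\})\big).$$ Here $\{0,\pm1\}$ is the set of periodic points (all of them fixed points), there are no minimal components, and the other sets are the attracting basin of $\{0,\pm1\}$.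
   Context: $\mathbb{Z}_3$ is the ring of $3$-adic integers with its $3$-adic metric. For a polynomial $f$ over $\mathbb{Z}_p$, a minimal decomposition of $\mathbb{Z}_p$ for $f$ is a partition $\mathbb{Z}_p=\mathcal{P}\sqcup\mathcal{M}\sqcup\mathcal{B}$ where (1) $\mathcal{P}$ is the set of all periodic points of $f$; (2) $\mathcal{M}=\bigsqcup_i\mathcal{M}_i$ is a disjoint union of at most countably many clopen $f$-invariant sets, each a finite union of balls, such that each subsystem $f:\mathcal{M}_i\to\mathcal{M}_i$ is minimal (every forward orbit in $\mathcal{M}_i$ is dense in $\mathcal{M}_i$); the $\mathcal{M}_i$ are called minimal components; (3) each point of $\mathcal{B}$ lies in the attracting basin of a periodic orbit or of a minimal component. A point $x$ lies in the attracting basin of a closed invariant set $A$ if the distance from $f^n(x)$ to $A$ tends to $0$ as $n\to\infty$; in describing $\mathcal{B}$, the attracting set itself is not listed as part of its basin. *)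

theory Defs
  imports "HOL-Analysis.Analysis" "HOL-Library.Numeral_Type" "HOL-Number_Theory.Cong"
begin

text \<open>
  The \<open>p\<close>-adic integers as the inverse limit of the rings \<open>\<int>/p\<^sup>n\<int>\<close>, where \<open>p = CARD('p)\<close>; an element
  is its compatible sequence of residues in \<open>{0..<p\<^sup>n}\<close>. In particular \<open>3 padic_int\<close> is \<open>\<int>\<^sub>3\<close>.
  Primality of \<open>p\<close> plays no role in the construction of the ring and its metric, so only
  \<open>p \<ge> 2\<close> (class \<open>card2\<close>) is required.
\<close>

typedef (overloaded) ('p::card2) padic_int =
  "{x :: nat \<Rightarrow> int. \<forall>n. x n \<in> {0..<int CARD('p) ^ n} \<and> x (Suc n) mod int CARD('p) ^ n = x n}"
  morphisms residue Abs_padic_int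
  by (rule exI[of _ "\<lambda>_. 0"]) auto

setup_lifting type_definition_padic_int

lemma padic_mod_mod_Suc: "a mod int CARD('p::card2) ^ Suc n mod int CARD('p) ^ n = a mod int CARD('p) ^ n"
  by (rule mod_mod_cancel) (simp add: le_imp_power_dvd)

lemma padic_mem_iff:
  "(\<forall>n. x n \<in> {0..<int CARD('p::card2) ^ n} \<and> x (Suc n) mod int CARD('p) ^ n = x n) \<longleftrightarrow>
   (\<forall>n. x (Suc n) mod int CARD('p) ^ n = x n)"
proof
  assume *: "\<forall>n. x (Suc n) mod int CARD('p) ^ n = x n"
  have "x n \<in> {0..<int CARD('p) ^ n}" for n
  proof -
    have "x n = x (Suc n) mod int CARD('p) ^ n" using * by simp
    moreover have "(0::int) < int CARD('p) ^ n" by simp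
    ultimately show ?thesis
      by (simp only: atLeastLessThan_iff) (metis pos_mod_bound pos_mod_sign)
  qed
  with * show "\<forall>n. x n \<in> {0..<int CARD('p) ^ n} \<and> x (Suc n) mod int CARD('p) ^ n = x n" by blast
qed blast

lemma padic_mod_range: "a mod int CARD('p::card2) ^ n \<in> {0..<int CARD('p) ^ n}"
  by simp

lemma padic_mod_arith:
  fixes a b a' b' q :: int
  assumes "a' mod q = a" "b' mod q = b"
  shows "(a' + b') mod q = (a + b) mod q" "(a' - b') mod q = (a - b) mod q"
    "(- a') mod q = (- a) mod q" "(a' * b') mod q = (a * b) mod q"
  unfolding assms[symmetric] by (simp_all add: mod_simps)

instantiation padic_int :: (card2) comm_ring_1
begin

lift_definition zero_padic_int :: "'a padic_int" is "\<lambda>n. 0" by simp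

lift_definition one_padic_int :: "'a padic_int" is "\<lambda>n. 1 mod int CARD('a) ^ n"
  by (simp only: padic_mod_mod_Suc padic_mod_range simp_thms)

lift_definition plus_padic_int :: "'a padic_int \<Rightarrow> 'a padic_int \<Rightarrow> 'a padic_int"
  is "\<lambda>x y n. (x n + y n) mod int CARD('a) ^ n"
  by (simp only: padic_mod_mod_Suc padic_mod_range simp_thms) (rule padic_mod_arith, (simp (no_asm_simp))+)

lift_definition minus_padic_int :: "'a padic_int \<Rightarrow> 'a padic_int \<Rightarrow> 'a padic_int"
  is "\<lambda>x y n. (x n - y n) mod int CARD('a) ^ n"
  by (simp only: padic_mod_mod_Suc padic_mod_range simp_thms) (rule padic_mod_arith, (simp (no_asm_simp))+)

lift_definition uminus_padic_int :: "'a padic_int \<Rightarrow> 'a padic_int"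
  is "\<lambda>x n. (- x n) mod int CARD('a) ^ n"
  by (simp only: padic_mod_mod_Suc padic_mod_range simp_thms) (rule padic_mod_arith, (simp (no_asm_simp))+)

lift_definition times_padic_int :: "'a padic_int \<Rightarrow> 'a padic_int \<Rightarrow> 'a padic_int"
  is "\<lambda>x y n. (x n * y n) mod int CARD('a) ^ n"
  by (simp only: padic_mod_mod_Suc padic_mod_range simp_thms) (rule padic_mod_arith, (simp (no_asm_simp))+)

instance
proof
  fix a b c :: "'a padic_int"
  show "a * b * c = a * (b * c)" by transfer (simp add: mod_simps mult.assoc)
  show "a * b = b * a" by transfer (simp add: mult.commute)
  show "1 * a = a" by transfer (auto simp: mod_simps fun_eq_iff)
  show "a + b + c = a + (b + c)" by transfer (simp add: mod_simps add.assoc)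
  show "a + b = b + a" by transfer (simp add: add.commute)
  show "0 + a = a" by transfer (auto simp: fun_eq_iff)
  show "- a + a = 0" by transfer (simp add: mod_simps)
  show "a - b = a + - b" by transfer (simp add: mod_simps)
  show "(a + b) * c = a * c + b * c" by transfer (simp add: mod_simps distrib_right)
  show "(0::'a padic_int) \<noteq> 1"
  proof (transfer, rule notI)
    assume "(\<lambda>n. 0) = (\<lambda>n. 1 mod int CARD('a) ^ n)"
    from fun_cong[OF this, of 1] show False using one_less_card[where 'a='a] by simp
  qed
qed

end

lemma residue_of_nat: "residue (of_nat k :: 'p::card2 padic_int) n = int k mod int CARD('p) ^ n"
  by (induction k) (simp_all add: zero_padic_int.rep_eq one_padic_int.rep_eq plus_padic_int.rep_eq mod_simps)

lemma residue_mod: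
  fixes x :: "'p::card2 padic_int"
  assumes "n \<le> m"
  shows "residue x m mod int CARD('p) ^ n = residue x n"
  using assms
proof (induction m rule: dec_induct)
  case base
  show ?case using residue[of x] by simp
next
  case (step m)
  have "residue x (Suc m) mod int CARD('p) ^ n
      = residue x (Suc m) mod int CARD('p) ^ m mod int CARD('p) ^ n"
    using step by (simp add: mod_mod_cancel le_imp_power_dvd)
  also have "residue x (Suc m) mod int CARD('p) ^ m = residue x m" using residue[of x] by simp
  finally show ?case using step by simp
qed

lemma residue_eq_0_iff:
  fixes x :: "'p::card2 padic_int"
  shows "residue x n = 0 \<longleftrightarrow> of_nat CARD('p) ^ n dvd x"
proof
  assume "of_nat CARD('p) ^ n dvd x"
  then obtain y where "x = of_nat (CARD('p) ^ n) * y" by auto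
  then show "residue x n = 0"
    by (simp only: times_padic_int.rep_eq residue_of_nat) simp
next
  assume 0: "residue x n = 0"
  let ?p = "int CARD('p)"
  define y where "y k = residue x (n + k) div ?p ^ n" for k
  have dvd: "?p ^ n * y k = residue x (n + k)" for k
    using residue_mod[of n "n + k" x] 0 by (auto simp: y_def)
  have "y (Suc k) mod ?p ^ k = y k" for k
  proof -
    have "?p ^ n * (y (Suc k) mod ?p ^ k) = (?p ^ n * y (Suc k)) mod ?p ^ (n + k)"
      by (simp only: power_add mult_mod_right)
    also have "\<dots> = ?p ^ n * y k"
      unfolding dvd by (rule residue_mod) simp
    finally show ?thesis by simp
  qed
  then have mem: "y \<in> {x. \<forall>n. x n \<in> {0..<?p ^ n} \<and> x (Suc n) mod ?p ^ n = x n}"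
    unfolding padic_mem_iff mem_Collect_eq by blast
  define z :: "'p padic_int" where "z = Abs_padic_int y"
  have z: "residue z = y" using mem by (simp only: z_def Abs_padic_int_inverse)
  have "x = of_nat (CARD('p) ^ n) * z"
  proof (rule residue_inject[THEN iffD1], rule ext)
    fix k
    have "residue (of_nat (CARD('p) ^ n) * z) k = (?p ^ n * y k) mod ?p ^ k"
      by (simp only: times_padic_int.rep_eq residue_of_nat z
        mod_mult_left_eq of_nat_power[where 'a = int])
    also have "\<dots> = residue x k" unfolding dvd by (rule residue_mod) simp
    finally show "residue x k = residue (of_nat (CARD('p) ^ n) * z) k" by (rule sym)
  qed
  then show "of_nat CARD('p) ^ n dvd x" by simp
qed

definition padic_val :: "'p::card2 padic_int \<Rightarrow> nat" where
  "padic_val x = (GREATEST n. of_nat CARD('p) ^ n dvd x)"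

lemma power_dvd_iff_le_padic_val:
  fixes x :: "'p::card2 padic_int"
  assumes "x \<noteq> 0"
  shows "of_nat CARD('p) ^ n dvd x \<longleftrightarrow> n \<le> padic_val x"
proof -
  let ?P = "\<lambda>n. of_nat CARD('p) ^ n dvd x"
  have down: "?P k" if "?P l" "k \<le> l" for k l
    using le_imp_power_dvd[OF that(2)] that(1) by (rule dvd_trans)
  obtain N where "residue x N \<noteq> 0"
    using assms residue_inject[of x 0] by (auto simp: zero_padic_int.rep_eq)
  then have N: "\<not> ?P N" by (simp add: residue_eq_0_iff)
  have bound: "k \<le> N" if "?P k" for k
    using N down[OF that, of N] by (meson nat_le_linear)
  have "?P (padic_val x)" unfolding padic_val_def
    by (rule GreatestI_nat[where k = 0 and b = N]) (use bound in auto)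
  moreover have "k \<le> padic_val x" if "?P k" for k
    unfolding padic_val_def by (rule Greatest_le_nat[where b = N]) (use bound that in auto)
  ultimately show ?thesis using down by blast
qed

text \<open>The \<open>p\<close>-adic metric, normalised by \<open>\<bar>p\<bar> = 1/p\<close>.\<close>

instantiation padic_int :: (card2) metric_space
begin

definition dist_padic_int :: "'a padic_int \<Rightarrow> 'a padic_int \<Rightarrow> real" where
  "dist_padic_int x y = (if x = y then 0 else 1 / real CARD('a) ^ padic_val (x - y))"

definition uniformity_padic_int :: "('a padic_int \<times> 'a padic_int) filter" where
  "uniformity_padic_int = (INF e\<in>{0 <..}. principal {(x, y). dist x y < e})"

definition open_padic_int :: "'a padic_int set \<Rightarrow> bool" where
  "open_padic_int U \<longleftrightarrow> (\<forall>x\<in>U. \<forall>\<^sub>F (x', y) in uniformity. x' = x \<longrightarrow> y \<in> U)"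

instance
proof
  fix x y z :: "'a padic_int"
  let ?p = "real CARD('a)"
  have p: "1 < ?p" using one_less_card[where 'a='a] by simp
  have le_iff: "dist a b \<le> 1 / ?p ^ n \<longleftrightarrow> of_nat CARD('a) ^ n dvd a - b" for a b :: "'a padic_int" and n
    using p power_dvd_iff_le_padic_val[of "a - b" n]
    by (auto simp: dist_padic_int_def field_simps)
  show "dist x y = 0 \<longleftrightarrow> x = y" using p by (simp add: dist_padic_int_def)
  show "dist x y \<le> dist x z + dist y z"
  proof (cases "x = z \<or> y = z")
    case True
    have "of_nat CARD('a) ^ n dvd x - y \<longleftrightarrow> of_nat CARD('a) ^ n dvd y - x" for n
      using dvd_minus_iff[of "of_nat CARD('a) ^ n" "x - y"] by simp
    then have "dist x y = dist y x"
      by (simp add: dist_padic_int_def padic_val_def)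
    with True p show ?thesis by (auto simp: dist_padic_int_def)
  next
    case False
    define n where "n = min (padic_val (x - z)) (padic_val (y - z))"
    have xz: "x - z \<noteq> 0" and yz: "y - z \<noteq> 0" using False by simp_all
    have "of_nat CARD('a) ^ n dvd x - z" "of_nat CARD('a) ^ n dvd y - z"
      unfolding power_dvd_iff_le_padic_val[OF xz] power_dvd_iff_le_padic_val[OF yz] n_def by simp_all
    from dvd_diff[OF this] have "of_nat CARD('a) ^ n dvd x - y" by simp
    then have "dist x y \<le> 1 / ?p ^ n" by (simp add: le_iff)
    also have "\<dots> \<le> dist x z + dist y z"
      using False p by (auto simp: dist_padic_int_def n_def min_def)
    finally show ?thesis .
  qed
qed (fact uniformity_padic_int_def open_padic_int_def)+

end

definition orbit_of :: "('a \<Rightarrow> 'a) \<Rightarrow> 'a \<Rightarrow> 'a set" where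
  "orbit_of f x = range (\<lambda>n. (f ^^ n) x)"

definition periodic_points :: "('a \<Rightarrow> 'a) \<Rightarrow> 'a set" where
  "periodic_points f = {x. \<exists>n>0. (f ^^ n) x = x}"

text \<open>
  Meant for closed invariant \<open>A\<close>. Points of \<open>A\<close> itself belong to the basin and have to be
  removed explicitly where they are not to be listed.
\<close>

definition attracting_basin :: "('a::metric_space \<Rightarrow> 'a) \<Rightarrow> 'a set \<Rightarrow> 'a set" where
  "attracting_basin f A = {x. (\<lambda>n. infdist ((f ^^ n) x) A) \<longlonglongrightarrow> 0}"

definition minimal_component :: "('a::metric_space \<Rightarrow> 'a) \<Rightarrow> 'a set \<Rightarrow> bool" where
  "minimal_component f M \<longleftrightarrow>
     M \<noteq> {} \<and> open M \<and> closed M \<and>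
     (\<exists>C. finite C \<and> (\<forall>(a, r)\<in>C. r > 0) \<and> M = (\<Union>(a, r)\<in>C. ball a r)) \<and>
     f ` M \<subseteq> M \<and>
     (\<forall>x\<in>M. M \<subseteq> closure (orbit_of f x))"

text \<open>
  \<open>Ms\<close> is the family of the minimal components \<open>M\<^sub>i\<close>, whose union is the middle part of the partition;
  parts of the partition may be empty.
\<close>

definition minimal_decomposition ::
  "('a::metric_space \<Rightarrow> 'a) \<Rightarrow> 'a set \<Rightarrow> 'a set set \<Rightarrow> 'a set \<Rightarrow> bool" where
  "minimal_decomposition f P Ms B \<longleftrightarrow>
     P \<union> \<Union>Ms \<union> B = UNIV \<and> P \<inter> \<Union>Ms = {} \<and> P \<inter> B = {} \<and> \<Union>Ms \<inter> B = {} \<and>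
     P = periodic_points f \<and>
     countable Ms \<and> disjoint Ms \<and> (\<forall>M\<in>Ms. minimal_component f M) \<and>
     (\<forall>x\<in>B. (\<exists>y\<in>periodic_points f. x \<in> attracting_basin f (orbit_of f y)) \<or>
            (\<exists>M\<in>Ms. x \<in> attracting_basin f M))"

end

theory Submission
  imports Defs
begin

text \<open>
  If \<open>3\<close> divides \<open>m\<close> and \<open>x - y\<close>, then \<open>x\<^sup>m - y\<^sup>m = (x - y) \<Sum> y\<^bsup>m-1-i\<^esup> x\<^sup>i\<close> is divisible by one more
  power of \<open>3\<close> than \<open>x - y\<close>, because the sum is congruent to \<open>m y\<^bsup>m-1\<^esup>\<close> modulo \<open>x - y\<close>. Hence points in
  the same residue class modulo \<open>3\<close> have asymptotic orbits, so every orbit converges to one of the fixed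
  points \<open>0, 1\<close> (and \<open>-1\<close> if \<open>m\<close> is odd). As \<open>\<int>\<^sub>3\<close> has no isolated points, a clopen invariant set contains
  such a limit point properly and so is not minimal.
\<close>

text \<open>The hypothesis \<open>d dvd x - y\<close> is stated separately because
  \<open>k = 0\<close> is allowed, and then the first hypothesis says nothing.\<close>

lemma power_Suc_dvd_power_diff:
  fixes d x y :: "'a::comm_ring_1"
  assumes "d ^ k dvd x - y" and "d dvd x - y" and "d dvd of_nat m"
  shows "d ^ Suc k dvd x ^ m - y ^ m"
proof -
  let ?S = "\<Sum>i<m. y ^ (m - Suc i) * x ^ i"
  have "(\<Sum>i<m. y ^ (m - Suc i) * (x ^ i - y ^ i)) = ?S - (\<Sum>i<m. y ^ (m - 1))"
    unfolding sum_subtractf[symmetric]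
    by (rule sum.cong) (simp_all add: right_diff_distrib flip: power_add)
  then have S: "?S = of_nat m * y ^ (m - 1) + (\<Sum>i<m. y ^ (m - Suc i) * (x ^ i - y ^ i))"
    by simp
  have "d dvd x ^ i - y ^ i" for i
    using assms(2) by (simp add: power_diff_sumr2)
  then have "d dvd ?S"
    unfolding S using assms(3) by (intro dvd_add dvd_sum) simp_all
  with assms(1) have "d ^ k * d dvd (x - y) * ?S"
    by (rule mult_dvd_mono)
  then show ?thesis
    by (simp add: power_diff_sumr2 mult.commute)
qed

lemma funpow_power_diff_dvd:
  fixes d x y :: "'a::comm_ring_1"
  assumes "d dvd x - y" and "d dvd of_nat m"
  shows "d ^ Suc n dvd ((\<lambda>x. x ^ m) ^^ n) x - ((\<lambda>x. x ^ m) ^^ n) y"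
proof (induction n)
  case 0
  show ?case using assms(1) by simp
next
  case (Suc n)
  then show ?case
    \<comment> \<open>Unfolding \<open>d ^ Suc n\<close> to \<open>d * d ^ n\<close> lets
      \<open>dvd_mult_left\<close> extract divisibility by \<open>d\<close> itself from the
      induction hypothesis.\<close>
    using power_Suc_dvd_power_diff[OF Suc.IH dvd_mult_left[OF Suc.IH[unfolded power_Suc]] assms(2)]
    by simp
qed

lemma dvd_diff_iff_residue_eq:
  fixes x y :: "'p::card2 padic_int"
  shows "of_nat CARD('p) ^ n dvd x - y \<longleftrightarrow> residue x n = residue y n"
proof -
  \<comment> \<open>Residues are stored in reduced form, so congruence modulo
    \<open>CARD('p) ^ n\<close> is plain equality.\<close>
  have "residue z n mod int CARD('p) ^ n = residue z n" for z :: "'p padic_int"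
    using residue_mod[of n n z] by simp
  then show ?thesis
    by (metis residue_eq_0_iff minus_padic_int.rep_eq mod_eq_dvd_iff mod_0_imp_dvd dvd_imp_mod_0)
qed

lemma dist_padic_int_le:
  fixes x y :: "'p::card2 padic_int"
  assumes "of_nat CARD('p) ^ n dvd x - y"
  shows "dist x y \<le> (1 / real CARD('p)) ^ n"
proof (cases "x = y")
  case False
  then have "n \<le> padic_val (x - y)"
    using assms power_dvd_iff_le_padic_val[of "x - y" n] by simp
  moreover have "1 \<le> real CARD('p)"
    using one_less_card[where 'a='p] by simp
  ultimately show ?thesis
    using False by (simp add: dist_padic_int_def power_one_over field_simps power_increasing)
qed simp

lemma dist_padic_int_tendsto_0:
  fixes u v :: "nat \<Rightarrow> 'p::card2 padic_int"
  assumes "\<And>n. of_nat CARD('p) ^ n dvd u n - v n"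
  shows "(\<lambda>n. dist (u n) (v n)) \<longlonglongrightarrow> 0"
proof (rule tendsto_sandwich[where f = "\<lambda>_. 0"])
  show "(\<lambda>n. (1 / real CARD('p)) ^ n) \<longlonglongrightarrow> 0"
    using one_less_card[where 'a='p] by (intro LIMSEQ_power_zero) simp
  show "\<forall>\<^sub>F n in sequentially. dist (u n) (v n) \<le> (1 / real CARD('p)) ^ n"
    using assms by (intro always_eventually allI dist_padic_int_le)
qed auto

text \<open>The points \<open>a + ?p ^ n\<close> tend to \<open>a\<close> and differ from it. This
  is what later rules out a minimal component consisting of one point.\<close>

instance padic_int :: (card2) perfect_space
proof
  fix a :: "'a padic_int"
  let ?p = "of_nat CARD('a) :: 'a padic_int"
  have "(\<lambda>n. dist (a + ?p ^ n) a) \<longlonglongrightarrow> 0"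
    by (rule dist_padic_int_tendsto_0) simp
  then have lim: "(\<lambda>n. a + ?p ^ n) \<longlonglongrightarrow> a"
    by (rule tendsto_dist_iff[THEN iffD2])
  \<comment> \<open>One level above \<open>n\<close>, the power \<open>?p ^ n\<close> is smaller
    than the modulus and so is its own nonzero residue.\<close>
  have "residue (?p ^ n) (Suc n) \<noteq> residue 0 (Suc n)" for n
    using residue_of_nat[of "CARD('a) ^ n" "Suc n", where 'p='a] one_less_card[where 'a='a]
    by (simp add: zero_padic_int.rep_eq)
  then have "?p ^ n \<noteq> 0" for n
    by metis
  then show "\<not> open {a}"
    using topological_tendstoD[OF lim, of "{a}"] by auto
qed

lemma funpow_fixpoint: "f e = e \<Longrightarrow> (f ^^ n) e = e"
  by (induction n) simp_all

text \<open>Separates the topology from the arithmetic: for the power map it remains to exhibit the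
  fixed points and prove convergence to them.\<close>

lemma convergent_orbits_decomposition:
  fixes f :: "'a::{metric_space, perfect_space} \<Rightarrow> 'a"
  assumes fixed: "\<And>e. e \<in> P \<Longrightarrow> f e = e"
    and conv: "\<And>x. \<exists>e\<in>P. (\<lambda>n. (f ^^ n) x) \<longlonglongrightarrow> e"
  shows "minimal_decomposition f P {} (- P)"
    and "\<nexists>M. minimal_component f M"
    and "attracting_basin f P = UNIV"
proof -
  have orbit: "orbit_of f e = {e}" if "e \<in> P" for e
    using fixed[OF that] by (auto simp: orbit_of_def funpow_fixpoint)
  have basin: "x \<in> attracting_basin f A" if "(\<lambda>n. (f ^^ n) x) \<longlonglongrightarrow> e" "e \<in> A" for x e A
    using tendsto_infdist[OF that(1), of A] that(2) by (simp add: attracting_basin_def)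
  have "x \<in> P" if "x \<in> periodic_points f" for x
  proof -
    obtain n where n: "n > 0" "(f ^^ n) x = x"
      using \<open>x \<in> periodic_points f\<close> by (force simp: periodic_points_def)
    obtain e where e: "e \<in> P" "(\<lambda>k. (f ^^ k) x) \<longlonglongrightarrow> e"
      using conv by blast
    \<comment> \<open>Along multiples of the period the orbit is constantly \<open>x\<close>, so
      \<open>x\<close> equals the limit \<open>e\<close>.\<close>
    have "(\<lambda>k. (f ^^ (n * k)) x) \<longlonglongrightarrow> e"
      using LIMSEQ_subseq_LIMSEQ[OF e(2), of "\<lambda>k. n * k"] n(1) by (simp add: strict_mono_def o_def)
    moreover have "(f ^^ (n * k)) x = x" for k
      using n(2) by (simp add: funpow_mult[symmetric] funpow_fixpoint)
    ultimately show ?thesis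
      using e(1) by (simp add: LIMSEQ_const_iff)
  qed
  moreover have "e \<in> periodic_points f" if "e \<in> P" for e
    unfolding periodic_points_def using fixed[OF that] by (auto intro!: exI[of _ 1])
  ultimately have per: "periodic_points f = P"
    by blast
  have "\<exists>e\<in>P. x \<in> attracting_basin f (orbit_of f e)" for x
    using conv[of x] basin orbit by auto
  then show "minimal_decomposition f P {} (- P)"
    by (simp add: minimal_decomposition_def per disjoint_def)
  show "attracting_basin f P = UNIV"
    using conv basin by blast
  show "\<nexists>M. minimal_component f M"
  proof
    assume "\<exists>M. minimal_component f M"
    then obtain M where "minimal_component f M" ..
    then have M: "M \<noteq> {}" "open M" "closed M" "f ` M \<subseteq> M"
      "\<And>x. x \<in> M \<Longrightarrow> M \<subseteq> closure (orbit_of f x)"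
      by (simp_all add: minimal_component_def)
    then obtain x where "x \<in> M" by blast
    then have orbit_M: "(f ^^ n) x \<in> M" for n
      using M(4) by (induction n) auto
    obtain e where e: "e \<in> P" "(\<lambda>n. (f ^^ n) x) \<longlonglongrightarrow> e"
      using conv by blast
    have "e \<in> M"
      by (rule closed_sequentially[OF M(3) orbit_M e(2)])
    \<comment> \<open>The orbit of \<open>e\<close> is the closed set \<open>{e}\<close>, so its
      density in \<open>M\<close> collapses \<open>M\<close> to an open singleton.\<close>
    with M(5)[of e] orbit[OF e(1)] have "M = {e}"
      by auto
    with M(2) show False
      using not_open_singleton by blast
  qed
qed

text \<open>The orbit of \<open>e\<close> is constant, so the comparison of two orbits becomes
  convergence to \<open>e\<close>.\<close>

lemma funpow_power_tendsto:
  fixes x e :: "'p::card2 padic_int"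
  assumes "of_nat CARD('p) dvd x - e" and "CARD('p) dvd m" and "e ^ m = e"
  shows "(\<lambda>n. ((\<lambda>x. x ^ m) ^^ n) x) \<longlonglongrightarrow> e"
proof (rule tendsto_dist_iff[THEN iffD2], rule dist_padic_int_tendsto_0)
  fix n
  have "of_nat CARD('p) dvd (of_nat m :: 'p padic_int)"
    using assms(2) unfolding dvd_def by (metis of_nat_mult)
  from funpow_power_diff_dvd[OF assms(1) this]
  show "of_nat CARD('p) ^ n dvd ((\<lambda>x. x ^ m) ^^ n) x - e"
    \<comment> \<open>The available exponent is \<open>Suc n\<close>; one factor is dropped.\<close>
    using dvd_mult_right assms(3) by (fastforce simp: funpow_fixpoint)
qed

text \<open>Turns the cosets of the theorem into conditions on the first residue; \<open>-1\<close>
  is represented by 2.\<close>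

lemma padic_3_residue_classes:
  fixes x :: "3 padic_int"
  shows "x \<in> {3 * z |z. True} \<longleftrightarrow> residue x 1 = 0"
    and "x \<in> {1 + 3 * z |z. True} \<longleftrightarrow> residue x 1 = 1"
    and "x \<in> {-1 + 3 * z |z. True} \<longleftrightarrow> residue x 1 = 2"
proof -
  have class_iff: "x \<in> {c + 3 * z |z. True} \<longleftrightarrow> residue x 1 = residue c 1" for c
    using dvd_diff_iff_residue_eq[of 1 x c] by (auto simp: dvd_def algebra_simps)
  show "x \<in> {3 * z |z. True} \<longleftrightarrow> residue x 1 = 0"
    using class_iff[of 0] by (simp add: zero_padic_int.rep_eq)
  show "x \<in> {1 + 3 * z |z. True} \<longleftrightarrow> residue x 1 = 1"
    using class_iff[of 1] by (simp add: one_padic_int.rep_eq)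
  show "x \<in> {-1 + 3 * z |z. True} \<longleftrightarrow> residue x 1 = 2"
    using class_iff[of "-1"] by (simp add: one_padic_int.rep_eq uminus_padic_int.rep_eq)
qed

lemma padic_3_residue_cases:
  fixes x :: "3 padic_int"
  obtains "residue x 1 = 0" | "residue x 1 = 1" | "residue x 1 = 2"
proof -
  have "residue x 1 \<in> {0..<3}"
    using residue[of x] by (auto dest: spec[of _ 1])
  then show thesis
    using that by fastforce
qed

lemma padic_3_residue_0_1_minus_1:
  "residue (0 :: 3 padic_int) 1 = 0" "residue (1 :: 3 padic_int) 1 = 1"
  "residue (- 1 :: 3 padic_int) 1 = 2"
  by (simp_all add: zero_padic_int.rep_eq one_padic_int.rep_eq uminus_padic_int.rep_eq)

lemma padic_3_funpow_power_tendsto: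
  fixes x e :: "3 padic_int"
  assumes "residue x 1 = residue e 1" and "3 dvd m" and "e ^ m = e"
  shows "(\<lambda>n. ((\<lambda>x. x ^ m) ^^ n) x) \<longlonglongrightarrow> e"
  using assms dvd_diff_iff_residue_eq[of 1 x e] by (intro funpow_power_tendsto) simp_all

theorem theorem4p1:
  fixes m :: nat and f :: "3 padic_int \<Rightarrow> 3 padic_int"
  assumes "m \<ge> 2" and "[m = 0] (mod 3)"
    and "f = (\<lambda>x. x ^ m)"
  shows "([m = 0] (mod 6) \<longrightarrow>
           (let P = {0, 1};
                B = ({3 * z |z. True} - {0}) \<union> ({1 + 3 * z |z. True} - {1}) \<union> {-1 + 3 * z |z. True}
            in minimal_decomposition f P {} B \<and>
               (\<forall>x\<in>P. f x = x) \<and>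
               (\<nexists>M. minimal_component f M) \<and>
               B = attracting_basin f P - P)) \<and>
         ([m = 3] (mod 6) \<longrightarrow>
           (let P = {0, 1, -1};
                B = ({3 * z |z. True} - {0}) \<union> ({1 + 3 * z |z. True} - {1}) \<union> ({-1 + 3 * z |z. True} - {-1})
            in minimal_decomposition f P {} B \<and>
               (\<forall>x\<in>P. f x = x) \<and>
               (\<nexists>M. minimal_component f M) \<and>
               B = attracting_basin f P - P))"
proof -
  have m: "3 dvd m" and m0: "m \<noteq> 0"
    using assms(1,2) by (auto simp: cong_0_iff)
  have tendsto: "(\<lambda>n. (f ^^ n) x) \<longlonglongrightarrow> e" if "residue x 1 = residue e 1" "e ^ m = e" for x e
    unfolding assms(3) using that m by (intro padic_3_funpow_power_tendsto)
  note residues = padic_3_residue_0_1_minus_1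
  show ?thesis
    unfolding Let_def
  \<comment> \<open>The pattern splits only the outer conjunction, whose first conjunct is an
    implication.\<close>
  proof (intro conjI[of "_ \<longrightarrow> _"] impI)
    let ?P = "{0, 1 :: 3 padic_int}"
    let ?B = "({3 * z |z. True} - {0}) \<union> ({1 + 3 * z |z. True} - {1}) \<union> {-1 + 3 * z |z. True :: bool} :: 3 padic_int set"
    assume "[m = 0] (mod 6)"
    then have "even m"
      using dvd_trans[of 2 6 m] by (simp add: cong_0_iff)
    have B: "?B = - ?P"
    proof (rule set_eqI)
      fix x
      show "x \<in> ?B \<longleftrightarrow> x \<in> - ?P"
        unfolding Un_iff Diff_iff padic_3_residue_classes
        by (cases x rule: padic_3_residue_cases) (use residues in auto)
    qed
    have fixed: "f e = e" if "e \<in> ?P" for e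
      using that m0 by (auto simp: assms(3) power_0_left)
    have conv: "\<exists>e\<in>?P. (\<lambda>n. (f ^^ n) x) \<longlonglongrightarrow> e" for x
    proof (cases x rule: padic_3_residue_cases)
      case 1
      then show ?thesis using tendsto[of x 0] m0 residues by (simp add: power_0_left)
    next
      case 2
      then show ?thesis using tendsto[of x 1] residues by simp
    next
      case 3
      \<comment> \<open>For even \<open>m\<close> the class of \<open>-1\<close> contains no fixed
        point, but one application of \<open>f\<close> moves it into the class of 1. Convergence is
        proved for \<open>f x\<close> and the index is then shifted back.\<close>
      then have "3 dvd x - (- 1)"
        using dvd_diff_iff_residue_eq[of 1 x "-1"] residues by simp
      then have "3 dvd x ^ m - (- 1) ^ m"
        by (simp add: power_diff_sumr2)
      then have "residue (f x) 1 = residue (1 :: 3 padic_int) 1"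
        using dvd_diff_iff_residue_eq[of 1 "f x" 1] \<open>even m\<close> by (simp add: assms(3))
      then have "(\<lambda>n. (f ^^ Suc n) x) \<longlonglongrightarrow> 1"
        unfolding funpow_Suc_right o_apply by (rule tendsto) simp
      then have "(\<lambda>n. (f ^^ n) x) \<longlonglongrightarrow> 1"
        by (rule LIMSEQ_imp_Suc)
      then show ?thesis
        by simp
    qed
    have "minimal_decomposition f ?P {} (- ?P)" "\<nexists>M. minimal_component f M"
      "attracting_basin f ?P = UNIV"
      by (rule convergent_orbits_decomposition[OF fixed conv]; assumption)+
    with fixed show "minimal_decomposition f ?P {} ?B \<and> (\<forall>x\<in>?P. f x = x) \<and> (\<nexists>M. minimal_component f M) \<and>
        ?B = attracting_basin f ?P - ?P"
      \<comment> \<open>Writing \<open>- ?P\<close> as \<open>UNIV - ?P\<close> matches it with the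
        basin minus \<open>?P\<close>, the basin being everything.\<close>
      unfolding B by (simp only: Compl_eq_Diff_UNIV) simp
  next
    let ?P = "{0, 1, -1 :: 3 padic_int}"
    let ?B = "({3 * z |z. True} - {0}) \<union> ({1 + 3 * z |z. True} - {1}) \<union> ({-1 + 3 * z |z. True :: bool} - {-1}) :: 3 padic_int set"
    assume "[m = 3] (mod 6)"
    then have "odd m"
      using cong_dvd_modulus_nat[of m 3 6 2] by (simp add: cong_def odd_iff_mod_2_eq_one)
    have B: "?B = - ?P"
    proof (rule set_eqI)
      fix x
      show "x \<in> ?B \<longleftrightarrow> x \<in> - ?P"
        unfolding Un_iff Diff_iff padic_3_residue_classes
        by (cases x rule: padic_3_residue_cases) (use residues in auto)
    qed
    have fixed: "f e = e" if "e \<in> ?P" for e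
      using that m0 \<open>odd m\<close> by (auto simp: assms(3) power_0_left)
    have conv: "\<exists>e\<in>?P. (\<lambda>n. (f ^^ n) x) \<longlonglongrightarrow> e" for x
    proof -
      \<comment> \<open>For odd \<open>m\<close> the fixed points \<open>0, 1, -1\<close> represent
        all residue classes modulo 3, so no preliminary step is required.\<close>
      obtain e where "e \<in> ?P" "residue x 1 = residue e 1"
        by (cases x rule: padic_3_residue_cases) (use residues in auto)
      then show ?thesis
        using tendsto[of x e] fixed[of e] by (auto simp: assms(3))
    qed
    have "minimal_decomposition f ?P {} (- ?P)" "\<nexists>M. minimal_component f M"
      "attracting_basin f ?P = UNIV"
      by (rule convergent_orbits_decomposition[OF fixed conv]; assumption)+
    with fixed show "minimal_decomposition f ?P {} ?B \<and> (\<forall>x\<in>?P. f x = x) \<and> (\<nexists>M. minimal_component f M) \<and>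
        ?B = attracting_basin f ?P - ?P"
      unfolding B by (simp only: Compl_eq_Diff_UNIV) simp
  qed
qed

end
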